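(* Let $m,n\geq 2$ and $1\leq k\leq n$ be integers, and let $C_{m,n,k}$ be the graph obtained by connecting $m$ path graphs $P_n$ through their $k$th vertices. Then the number of random walk labelings of $C_{m,n,k}$ is $$\mathcal{L}(C_{m,n,k})=\frac{1}{(m-1)!}\left(\frac{2}{n!}\binom{n-1}{k-1}\right)^{m-1}\Bigg(\frac{1}{(n-k)!}\sum_{y=2}^{k}\frac{2^{y-2}(mn-y)!}{(k-y)!}+\frac{1}{(k-1)!}\sum_{y=2}^{n-k+1}\frac{2^{y-2}(mn-y)!}{(n-k+1-y)!}+\frac{(mn-1)!}{(n-k)!(k-1)!}\Bigg).$$
   Context: Let $G$ be a finite connected undirected graph with vertex set $V$. A random walk labeling of $G$ is a labeling of $V$ obtainable by the following process: (1) set $i=1$, choose $v\in V$, and label $v$ with $i$; (2) as long as there are unlabeled vertices, pick $w\in V$ adjacent to $v$ and replace $v$ with $w$; if (the new) $v$ is not labeled, increase $i$ by $1$ and label $v$ with $i$. (Thus vertices are labeled $1,\ldots,|V|$ in the order of their first visit by a walk on $G$.) The number of distinct random walk labelings of $G$ is denoted $\mathcal{L}(G)$. The graph $C_{m,n,k}$ has vertex set $\{(i,j): 1\leq i\leq m,\ 1\leq j\leq n\}$; its edges are $\{(i,j),(i,j+1)\}$ for $1\leq i\leq m$, $1\leq j\leq n-1$ (forming $m$ copies of the path $P_n$), together with $\{(i,k),(i+1,k)\}$ for $1\leq i\leq m-1$. Empty sums equal $0$. *)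

theory Defs
  imports Complex_Main
begin

(* An undirected graph is given by its vertex set V and its set E of edges {u, v}.
   rw_reachable V E f i v: the process can be in the state where f is the current partial
   labeling (unlabeled vertices are mapped to None), i is the last label that was used, and
   the walk is at v. *)

inductive rw_reachable ::
  "'a set \<Rightarrow> 'a set set \<Rightarrow> ('a \<rightharpoonup> nat) \<Rightarrow> nat \<Rightarrow> 'a \<Rightarrow> bool"
  for V :: "'a set" and E :: "'a set set"
where
  start: "v \<in> V \<Longrightarrow> rw_reachable V E [v \<mapsto> 1] 1 v"
| step_labeled:
    "\<lbrakk>rw_reachable V E f i v; \<exists>u\<in>V. f u = None; w \<in> V; {v, w} \<in> E; f w \<noteq> None\<rbrakk>
      \<Longrightarrow> rw_reachable V E f i w"
| step_unlabeled:
    "\<lbrakk>rw_reachable V E f i v; \<exists>u\<in>V. f u = None; w \<in> V; {v, w} \<in> E; f w = None\<rbrakk>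
      \<Longrightarrow> rw_reachable V E (f(w \<mapsto> i + 1)) (i + 1) w"

definition random_walk_labeling ::
  "'a set \<Rightarrow> 'a set set \<Rightarrow> ('a \<rightharpoonup> nat) \<Rightarrow> bool"
where
  "random_walk_labeling V E f \<longleftrightarrow>
     (\<exists>i v. rw_reachable V E f i v) \<and> (\<forall>u\<in>V. f u \<noteq> None)"

definition num_random_walk_labelings :: "'a set \<Rightarrow> 'a set set \<Rightarrow> nat"
where
  "num_random_walk_labelings V E = card {f. random_walk_labeling V E f}"

definition C_verts :: "nat \<Rightarrow> nat \<Rightarrow> (nat \<times> nat) set"
where
  "C_verts m n = {(i, j). 1 \<le> i \<and> i \<le> m \<and> 1 \<le> j \<and> j \<le> n}"

definition C_edges :: "nat \<Rightarrow> nat \<Rightarrow> nat \<Rightarrow> (nat \<times> nat) set set"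
where
  "C_edges m n k =
     {{(i, j), (i, j + 1)} | i j. 1 \<le> i \<and> i \<le> m \<and> 1 \<le> j \<and> j \<le> n - 1} \<union>
     {{(i, k), (i + 1, k)} | i. 1 \<le> i \<and> i \<le> m - 1}"

end

theory Submission
  imports Defs
begin

text \<open>On a tree rooted at the start \<^term>\<open>r\<close> of the walk, a labeling is an ordering of the vertices in
  which parents precede children, so by the hook length formula there are $N!$ divided by the
  product of the subtree sizes of them. For $C_{m,n,k}$ rooted at \<^term>\<open>(a, b)\<close> this quotient is
  a function of \<^term>\<open>a\<close> times a function of \<^term>\<open>b\<close>. The sum over \<^term>\<open>a\<close> is a row sum of
  binomial coefficients, and the sum over \<^term>\<open>b\<close> on either side of \<^term>\<open>k\<close> is a partial row
  sum $\sum_{i \le K} \binom{M}{i} = \sum_{z \le K} 2^z \binom{M-1-z}{K-z}$.\<close>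

section \<open>Random walks as growth of a labeled set\<close>

text \<open>\<^term>\<open>grows V E f i g\<close>: the partial labeling \<^term>\<open>f\<close> with last label \<^term>\<open>i\<close> can be completed
  to \<^term>\<open>g\<close>. The position of the walk is dropped, since the walk can move freely within the
  labeled vertices.\<close>

inductive grows :: "'a set \<Rightarrow> 'a set set \<Rightarrow> ('a \<rightharpoonup> nat) \<Rightarrow> nat \<Rightarrow> ('a \<rightharpoonup> nat) \<Rightarrow> bool"
  for V :: "'a set" and E :: "'a set set"
where
  complete: "\<forall>u\<in>V. f u \<noteq> None \<Longrightarrow> grows V E f i f"
| step: "\<lbrakk>w \<in> V; f w = None; u \<in> V; f u \<noteq> None; {u, w} \<in> E; grows V E (f(w \<mapsto> i + 1)) (i + 1) g\<rbrakk>
    \<Longrightarrow> grows V E f i g"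

lemma rw_reachable_pos: "rw_reachable V E f i v \<Longrightarrow> v \<in> V \<and> f v \<noteq> None"
  by (induction rule: rw_reachable.induct) auto

lemma grows_complete: "grows V E f i g \<Longrightarrow> u \<in> V \<Longrightarrow> g u \<noteq> None"
  by (induction rule: grows.induct) auto

text \<open>Induction unwinds the walk to its start: a step onto a labeled vertex changes neither
  \<open>f\<close> nor \<open>i\<close>, and a step onto a new vertex is put in front of the growth,
  with the position of the walk as labeled neighbour.\<close>

lemma rw_reachable_grows:
  "rw_reachable V E f i v \<Longrightarrow> grows V E f i g \<Longrightarrow> \<exists>r\<in>V. grows V E [r \<mapsto> 1] 1 g"
proof (induction rule: rw_reachable.induct)
  case (step_unlabeled f i v w)
  with rw_reachable_pos[OF step_unlabeled.hyps(1)] show ?case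
    by (blast intro: grows.step)
qed auto

definition adjacent_in :: "'a set \<Rightarrow> 'a set set \<Rightarrow> ('a \<rightharpoonup> nat) \<Rightarrow> 'a \<Rightarrow> 'a \<Rightarrow> bool" where
  "adjacent_in V E f a b \<longleftrightarrow> b \<in> V \<and> {a, b} \<in> E \<and> f b \<noteq> None"

text \<open>The walk can retrace its steps: each new position is joined back to the previous one,
  which is labeled and from which the induction hypothesis reaches the rest.\<close>

lemma rw_reachable_labeled_connected:
  "rw_reachable V E f i v \<Longrightarrow> f u \<noteq> None \<Longrightarrow> (adjacent_in V E f)\<^sup>*\<^sup>* v u"
proof (induction arbitrary: u rule: rw_reachable.induct)
  case (start v)
  then show ?case by (auto split: if_splits)
next
  case (step_labeled f i v w)
  have "adjacent_in V E f w v"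
    using step_labeled.hyps rw_reachable_pos[OF step_labeled.hyps(1)]
    by (auto simp: adjacent_in_def insert_commute)
  then show ?case using step_labeled.IH[OF step_labeled.prems]
    by (rule converse_rtranclp_into_rtranclp)
next
  case (step_unlabeled f i v w)
  let ?f' = "f(w \<mapsto> i + 1)"
  have mono: "(adjacent_in V E ?f')\<^sup>*\<^sup>* a b" if "(adjacent_in V E f)\<^sup>*\<^sup>* a b" for a b
    using that by (rule rtranclp_mono[THEN predicate2D, rotated]) (auto simp: adjacent_in_def)
  show ?case
  proof (cases "u = w")
    case False
    have "adjacent_in V E ?f' w v"
      using step_unlabeled.hyps rw_reachable_pos[OF step_unlabeled.hyps(1)]
      by (auto simp: adjacent_in_def insert_commute)
    moreover have "(adjacent_in V E ?f')\<^sup>*\<^sup>* v u"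
      using step_unlabeled.IH[of u] step_unlabeled.prems False mono by simp
    ultimately show ?thesis by (rule converse_rtranclp_into_rtranclp)
  qed auto
qed

lemma rw_reachable_walk:
  assumes "(adjacent_in V E f)\<^sup>*\<^sup>* v u" "rw_reachable V E f i v" "\<exists>u\<in>V. f u = None"
  shows "rw_reachable V E f i u"
  using assms
  by (induction rule: rtranclp_induct)
    (auto simp: adjacent_in_def intro: rw_reachable.step_labeled)

text \<open>Before each growth step the walk moves through labeled vertices to the chosen neighbour
  \<open>u\<close>; it may still move because \<open>w\<close> is unlabeled.\<close>

lemma grows_rw_reachable:
  "grows V E f i g \<Longrightarrow> rw_reachable V E f i v \<Longrightarrow> \<exists>j u. rw_reachable V E g j u"
proof (induction arbitrary: v rule: grows.induct)
  case (step w f u i g)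
  have "rw_reachable V E f i u"
    using rw_reachable_walk[OF rw_reachable_labeled_connected[OF step.prems step.hyps(4)]
        step.prems] step.hyps(1,2) by blast
  then have "rw_reachable V E (f(w \<mapsto> i + 1)) (i + 1) w"
    using step.hyps by (intro rw_reachable.step_unlabeled) auto
  then show ?case by (rule step.IH)
qed blast

lemma random_walk_labeling_iff_grows:
  "random_walk_labeling V E g \<longleftrightarrow> (\<exists>r\<in>V. grows V E [r \<mapsto> 1] 1 g)"
proof
  assume g: "random_walk_labeling V E g"
  then obtain i v where "rw_reachable V E g i v"
    unfolding random_walk_labeling_def by blast
  moreover have "grows V E g i g"
    using g unfolding random_walk_labeling_def by (intro grows.complete) simp
  ultimately show "\<exists>r\<in>V. grows V E [r \<mapsto> 1] 1 g"
    by (rule rw_reachable_grows)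
next
  assume "\<exists>r\<in>V. grows V E [r \<mapsto> 1] 1 g"
  then obtain r where r: "r \<in> V" and g: "grows V E [r \<mapsto> 1] 1 g" by blast
  from grows_rw_reachable[OF g rw_reachable.start[OF r]] grows_complete[OF g]
  show "random_walk_labeling V E g"
    unfolding random_walk_labeling_def by blast
qed

lemma grows_extends: "grows V E f i g \<Longrightarrow> f x = Some l \<Longrightarrow> g x = Some l"
proof (induction rule: grows.induct)
  case (step w f u i g)
  then show ?case by (cases "x = w") auto
qed

text \<open>With \<open>grows_extends\<close> this makes the order of labeling readable from
  \<open>g\<close>, which separates different starts and different choices of the next
  vertex.\<close>

lemma grows_new_labels:
  "grows V E f i g \<Longrightarrow> x \<in> V \<Longrightarrow> f x = None \<Longrightarrow> \<exists>l. g x = Some l \<and> i < l"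
proof (induction rule: grows.induct)
  case (step w f u i g)
  then show ?case
    using grows_extends[OF step.hyps(6), of w "i + 1"] by (cases "x = w") fastforce+
qed auto

lemma num_random_walk_labelings_eq_sum:
  assumes "finite V" "\<And>r. r \<in> V \<Longrightarrow> finite {g. grows V E [r \<mapsto> 1] 1 g}"
  shows "num_random_walk_labelings V E = (\<Sum>r\<in>V. card {g. grows V E [r \<mapsto> 1] 1 g})"
proof -
  have disj: "{g. grows V E [r \<mapsto> 1] 1 g} \<inter> {g. grows V E [s \<mapsto> 1] 1 g} = {}"
    if "r \<in> V" "r \<noteq> s" for r s
  proof (rule ccontr)
    assume "\<not> ?thesis"
    then obtain g where g: "grows V E [r \<mapsto> 1] 1 g" "grows V E [s \<mapsto> 1] 1 g" by blast
    show False
      using grows_extends[OF g(1), of r 1] grows_new_labels[OF g(2) that(1)] that(2) by auto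
  qed
  have "{g. random_walk_labeling V E g} = (\<Union>r\<in>V. {g. grows V E [r \<mapsto> 1] 1 g})"
    by (auto simp: random_walk_labeling_iff_grows)
  then show ?thesis
    unfolding num_random_walk_labelings_def
    using assms disj by (simp add: card_UN_disjoint)
qed

subsection \<open>The hook length formula for rooted trees\<close>

text \<open>The value \<^term>\<open>h v\<close> is the number of descendants of \<^term>\<open>v\<close>; it is given by its recursion
  over the children, which is all that the counting argument needs.\<close>

locale hook_tree =
  fixes V :: "'a set" and E :: "'a set set" and r :: 'a and par :: "'a \<Rightarrow> 'a" and h :: "'a \<Rightarrow> nat"
  assumes finite_V: "finite V"
    and root: "r \<in> V"
    and edge_iff: "u \<in> V \<Longrightarrow> w \<in> V \<Longrightarrow>
      {u, w} \<in> E \<longleftrightarrow> (w \<noteq> r \<and> u = par w) \<or> (u \<noteq> r \<and> w = par u)"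
    and hook: "v \<in> V \<Longrightarrow> h v = 1 + sum h {w \<in> V. w \<noteq> r \<and> par w = v}"
    and hook_root: "h r = card V"
begin

definition frontier :: "'a set \<Rightarrow> 'a set" where
  "frontier S = {w \<in> V - S. par w \<in> S}"

definition rooted_closed :: "'a set \<Rightarrow> bool" where
  "rooted_closed S \<longleftrightarrow> S \<subseteq> V \<and> r \<in> S \<and> (\<forall>v\<in>S. v \<noteq> r \<longrightarrow> par v \<in> S)"

lemma rooted_closed_insert: "rooted_closed S \<Longrightarrow> w \<in> frontier S \<Longrightarrow> rooted_closed (insert w S)"
  by (auto simp: rooted_closed_def frontier_def)

text \<open>A closed set contains the parents of its non-root members, so an edge leaving it leads
  from parent to child. Hence the frontier is exactly what a growth step may label next.\<close>

lemma frontier_adjacent: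
  assumes "rooted_closed S"
  shows "w \<in> frontier S \<longleftrightarrow> w \<in> V - S \<and> (\<exists>u\<in>S. {u, w} \<in> E)"
proof (cases "w \<in> V - S")
  case True
  then have "{u, w} \<in> E \<longleftrightarrow> u = par w" if "u \<in> S" for u
    using assms that edge_iff[of u w] by (auto simp: rooted_closed_def)
  then show ?thesis using True by (auto simp: frontier_def)
qed (auto simp: frontier_def)

text \<open>Moving \<^term>\<open>w\<close> into the visited set replaces it in the frontier by its children.\<close>

lemma sum_frontier_insert:
  assumes S: "rooted_closed S" and w: "w \<in> frontier S"
  shows "sum h (frontier S) = Suc (sum h (frontier (insert w S)))"
proof -
  let ?C = "{x \<in> V. x \<noteq> r \<and> par x = w}"
  have fin: "finite (frontier S)" "finite ?C"
    using finite_V by (auto simp: frontier_def)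
  have "frontier (insert w S) = (frontier S - {w}) \<union> ?C"
    using S w by (auto simp: frontier_def rooted_closed_def)
  moreover have "(frontier S - {w}) \<inter> ?C = {}"
    using w by (auto simp: frontier_def)
  ultimately have "sum h (frontier (insert w S)) = sum h (frontier S - {w}) + sum h ?C"
    using fin by (simp add: sum.union_disjoint)
  moreover have "sum h (frontier S) = h w + sum h (frontier S - {w})"
    using fin w by (simp add: sum.remove)
  moreover have "h w = 1 + sum h ?C"
    using w hook by (simp add: frontier_def)
  ultimately show ?thesis by simp
qed

text \<open>The second assumption is an invariant: the hooks of the frontier add up to the number of
  unlabeled vertices. Labeling \<open>w\<close> next removes the factor \<open>h w\<close> from the
  product, so over the common product the counts for all \<open>w\<close> add up to this sum times a
  factorial. Multiplying by the product avoids division.\<close>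

lemma hook_length_aux:
  assumes "rooted_closed (dom f)" "sum h (frontier (dom f)) = card (V - dom f)"
  shows "finite {g. grows V E f i g} \<and>
    card {g. grows V E f i g} * prod h (V - dom f) = fact (card (V - dom f))"
  using assms
proof (induction "card (V - dom f)" arbitrary: f i)
  case 0
  then have *: "V \<subseteq> dom f" using finite_V by auto
  have "grows V E f i g \<longleftrightarrow> g = f" for g
    using * by (auto intro: grows.complete elim: grows.cases)
  moreover have empty: "V - dom f = {}" using * by blast
  ultimately show ?case unfolding empty by simp
next
  case (Suc c)
  let ?F = "frontier (dom f)"
  let ?G = "\<lambda>w. {g. grows V E (f(w \<mapsto> i + 1)) (i + 1) g}"
  have F: "finite ?F" using finite_V by (simp add: frontier_def)
  have cw: "card (V - dom (f(w \<mapsto> i + 1))) = c" if "w \<in> ?F" for w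
  proof -
    have "V - dom (f(w \<mapsto> i + 1)) = (V - dom f) - {w}" by auto
    then show ?thesis using that Suc.hyps(2) finite_V by (simp add: frontier_def)
  qed
  have IH: "finite (?G w)" "card (?G w) * prod h (V - dom f) = h w * fact c" if w: "w \<in> ?F" for w
  proof -
    have "dom (f(w \<mapsto> i + 1)) = insert w (dom f)" by simp
    then have "rooted_closed (dom (f(w \<mapsto> i + 1)))"
      "sum h (frontier (dom (f(w \<mapsto> i + 1)))) = card (V - dom (f(w \<mapsto> i + 1)))"
      using rooted_closed_insert[OF Suc.prems(1) w] sum_frontier_insert[OF Suc.prems(1) w]
        Suc.prems(2) Suc.hyps(2) cw[OF w] by (metis, metis nat.inject)
    from Suc.hyps(1)[OF cw[OF w, symmetric] this, of "i + 1"]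
    have *: "finite (?G w)" "card (?G w) * prod h (V - dom (f(w \<mapsto> i + 1))) = fact c"
      using cw[OF w] by auto
    show "finite (?G w)" by fact
    have "V - dom (f(w \<mapsto> i + 1)) = (V - dom f) - {w}" by auto
    moreover have "w \<in> V - dom f" using w by (simp add: frontier_def)
    ultimately have "prod h (V - dom f) = h w * prod h (V - dom (f(w \<mapsto> i + 1)))"
      using finite_V by (simp add: prod.remove)
    then show "card (?G w) * prod h (V - dom f) = h w * fact c"
      using *(2) by (simp add: algebra_simps)
  qed
  have ne: "\<not> (\<forall>u\<in>V. f u \<noteq> None)"
  proof
    assume "\<forall>u\<in>V. f u \<noteq> None"
    then have empty: "V - dom f = {}" by auto
    show False using Suc.hyps(2) unfolding empty by simp
  qed
  have eq: "{g. grows V E f i g} = (\<Union>w\<in>?F. ?G w)"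
  proof (intro equalityI subsetI)
    fix g assume "g \<in> {g. grows V E f i g}"
    then have "grows V E f i g" by simp
    then show "g \<in> (\<Union>w\<in>?F. ?G w)"
    proof cases
      case complete
      then show ?thesis using ne by blast
    next
      case (step w u)
      then have "w \<in> ?F" using frontier_adjacent[OF Suc.prems(1), of w] by auto
      then show ?thesis using step by blast
    qed
  next
    fix g assume "g \<in> (\<Union>w\<in>?F. ?G w)"
    then obtain w where w: "w \<in> ?F" "grows V E (f(w \<mapsto> i + 1)) (i + 1) g" by blast
    then obtain u where "u \<in> dom f" "{u, w} \<in> E" "w \<in> V - dom f"
      using frontier_adjacent[OF Suc.prems(1), of w] by auto
    then show "g \<in> {g. grows V E f i g}"
      using w Suc.prems(1) by (auto simp: rooted_closed_def intro!: grows.step[of w V f u])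
  qed
  \<comment> \<open>Labeling \<open>w\<close> next gives it the label \<open>i + 1\<close>; labeling
    \<open>w'\<close> next leaves \<open>w\<close> a larger one.\<close>
  have disj: "?G w \<inter> ?G w' = {}" if "w \<in> ?F" "w \<noteq> w'" for w w'
  proof -
    have "w \<in> V" "f w = None" using that by (auto simp: frontier_def)
    then have "\<not> grows V E (f(w' \<mapsto> i + 1)) (i + 1) g"
      if g: "grows V E (f(w \<mapsto> i + 1)) (i + 1) g" for g
      using grows_extends[OF g, of w "i + 1"] \<open>w \<noteq> w'\<close>
        grows_new_labels[of V E "f(w' \<mapsto> i + 1)" "i + 1" g w] by auto
    then show ?thesis by blast
  qed
  have "card {g. grows V E f i g} = (\<Sum>w\<in>?F. card (?G w))"
    unfolding eq using F IH(1) disj by (intro card_UN_disjoint) auto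
  then have "card {g. grows V E f i g} * prod h (V - dom f) = (\<Sum>w\<in>?F. h w * fact c)"
    using IH(2) by (simp add: sum_distrib_right)
  also have "\<dots> = Suc c * fact c"
    using Suc.prems(2) Suc.hyps(2) by (simp add: sum_distrib_right[symmetric])
  also have "\<dots> = fact (card (V - dom f))"
    by (simp flip: Suc.hyps(2))
  finally show ?case using F IH(1) by (simp add: eq)
qed

text \<open>The recursion at \<open>r\<close> and \<open>h r = card V\<close> give the invariant for
  \<open>{r}\<close>, whose frontier is the set of children of \<open>r\<close>. Multiplying by
  \<open>h r\<close> then brings the root back on both sides.\<close>

theorem hook_length_formula:
  shows "finite {g. grows V E [r \<mapsto> 1] 1 g}" (is ?A)
    and "card {g. grows V E [r \<mapsto> 1] 1 g} * prod h V = fact (card V)" (is ?B)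
proof -
  have dom: "dom [r \<mapsto> 1::nat] = {r}" by simp
  have 1: "rooted_closed {r}" using root by (simp add: rooted_closed_def)
  have "frontier {r} = {w \<in> V. w \<noteq> r \<and> par w = r}"
    by (auto simp: frontier_def)
  then have 2: "sum h (frontier {r}) = card (V - {r})"
    using hook[OF root] hook_root finite_V root by simp
  have *: "finite {g. grows V E [r \<mapsto> 1] 1 g} \<and>
    card {g. grows V E [r \<mapsto> 1] 1 g} * prod h (V - {r}) = fact (card (V - {r}))"
    using hook_length_aux[of "[r \<mapsto> 1]" 1] 1 2 unfolding dom by blast
  then show ?A by blast
  have "prod h V = card V * prod h (V - {r})"
    using finite_V root hook_root by (simp add: prod.remove)
  moreover have "fact (card V) = card V * fact (card (V - {r}))"
    using finite_V root by (metis card.remove diff_Suc_1 card_Diff_singleton fact_Suc of_nat_id)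
  ultimately show ?B using * by (simp add: algebra_simps)
qed

end

section \<open>The graph as a rooted tree with explicit subtree sizes\<close>

lemma C_edge_iff:
  "{(i, j), (i', j')} \<in> C_edges m n k \<longleftrightarrow>
     i = i' \<and> 1 \<le> i \<and> i \<le> m \<and> (j' = j + 1 \<and> 1 \<le> j \<and> j \<le> n - 1 \<or> j = j' + 1 \<and> 1 \<le> j' \<and> j' \<le> n - 1) \<or>
     j = k \<and> j' = k \<and> (i' = i + 1 \<and> 1 \<le> i \<and> i \<le> m - 1 \<or> i = i' + 1 \<and> 1 \<le> i' \<and> i' \<le> m - 1)"
  unfolding C_edges_def by (auto simp: doubleton_eq_iff)

text \<open>First step of the path to the root \<open>(a, b)\<close>. From another row this path
  runs to column \<open>k\<close>, along it to row \<open>a\<close>, then to column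
  \<open>b\<close>. The value at the root itself is a default.\<close>

definition C_par :: "nat \<Rightarrow> nat \<Rightarrow> nat \<Rightarrow> nat \<times> nat \<Rightarrow> nat \<times> nat" where
  "C_par k a b = (\<lambda>(i, j).
     if i = a then (i, if j < b then j + 1 else j - 1)
     else if j < k then (i, j + 1) else if j > k then (i, j - 1)
     else if i < a then (i + 1, j) else (i - 1, j))"

text \<open>Subtree sizes. Outside row \<open>a\<close>, a vertex off column \<open>k\<close> cuts
  off the tail of its path, and one on column \<open>k\<close> cuts off all rows on its side away
  from \<open>a\<close>. In row \<open>a\<close>, a subtree containing \<open>(a, k)\<close> misses
  only the vertices of that row on the side of the root, whence the terms with
  \<open>m * n\<close>.\<close>

definition C_hook :: "nat \<Rightarrow> nat \<Rightarrow> nat \<Rightarrow> nat \<Rightarrow> nat \<Rightarrow> nat \<times> nat \<Rightarrow> nat" where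
  "C_hook m n k a b = (\<lambda>(i, j).
     if i \<noteq> a then
       (if j < k then j else if j > k then n + 1 - j
        else if i < a then i * n else (m + 1 - i) * n)
     else if j < b then (if j < k then j else m * n - n + j)
     else if j = b then m * n
     else if j > k then n + 1 - j else m * n + 1 - j)"

text \<open>Eliminates the truncated subtractions of \<open>C_par\<close>, so that the edge
  condition becomes linear arithmetic.\<close>

lemma C_par_iff:
  assumes "1 \<le> i" "1 \<le> j"
  shows "(i', j') = C_par k a b (i, j) \<and> (i, j) \<noteq> (a, b) \<longleftrightarrow>
    i' = i \<and> (if i = a then j < b \<and> j' = j + 1 \<or> j > b \<and> j' + 1 = j
              else j < k \<and> j' = j + 1 \<or> j > k \<and> j' + 1 = j) \<or>
    i \<noteq> a \<and> j = k \<and> j' = k \<and> (i < a \<and> i' = i + 1 \<or> i > a \<and> i' + 1 = i)"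
  using assms by (auto simp: C_par_def)

text \<open>With \<^term>\<open>x\<close>, \<^term>\<open>y\<close> abstracting the products $i n$ and $(m - i - 1) n$, the hook recursion
  becomes linear arithmetic. The four summands are the children above, below, and in the two
  neighbouring copies of the path.\<close>

lemma C_hook_recursion_arith:
  fixes i j k n N x y a b :: nat
  assumes k: "1 \<le> k" "k \<le> n" "j < n" "1 \<le> b" "b \<le> n" and N: "N = x + n + y"
  shows "(if Suc i \<noteq> a then
       (if Suc j < k then Suc j else if Suc j > k then n + 1 - Suc j
        else if Suc i < a then x + n else y + n)
     else if Suc j < b then (if Suc j < k then Suc j else N - n + Suc j)
     else if Suc j = b then N
     else if Suc j > k then n + 1 - Suc j else N + 1 - Suc j) =
    1 + ((if (if Suc i = a then b else k) < j + 2
         then if k < j + 2 then n - Suc j else N - Suc j else 0) +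
        (if j < (if Suc i = a then b else k) then if j < k then j else N - n + j else 0) +
        (if Suc j = k \<and> a \<le> Suc i then y else 0) +
        (if Suc j = k \<and> Suc i \<le> a then x else 0))"
proof -
  \<comment> \<open>The differences are expressed through \<open>t\<close>, the number of vertices
    of the row beyond column \<open>Suc j\<close>.\<close>
  have 1: "N - n = x + y" "N - Suc j = x + y + (n - Suc j)" "N + 1 - Suc j = x + y + (n - Suc j) + 1"
    "n + 1 - Suc j = (n - Suc j) + 1" using assms by auto
  define t where "t = n - Suc j"
  then have t: "n - Suc j = t" "n = t + Suc j" using assms by auto
  consider "Suc j < k" | "Suc j = k" | "k < Suc j" by linarith
  then show ?thesis
    unfolding 1 unfolding t(1) N using k t(2)
    by cases (cases "Suc i" a rule: linorder_cases; cases "Suc j" b rule: linorder_cases; simp)+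
qed

lemma C_hook_tree:
  assumes "1 \<le> k" "k \<le> n" "1 \<le> a" "a \<le> m" "1 \<le> b" "b \<le> n"
  shows "hook_tree (C_verts m n) (C_edges m n k) (a, b) (C_par k a b) (C_hook m n k a b)"
proof
  have "C_verts m n = {1..m} \<times> {1..n}" by (auto simp: C_verts_def)
  then show "finite (C_verts m n)" "C_hook m n k a b (a, b) = card (C_verts m n)"
    by (auto simp: C_hook_def)
  show "(a, b) \<in> C_verts m n" using assms by (simp add: C_verts_def)
  show "{u, w} \<in> C_edges m n k \<longleftrightarrow>
    (w \<noteq> (a, b) \<and> u = C_par k a b w) \<or> (u \<noteq> (a, b) \<and> w = C_par k a b u)"
    if "u \<in> C_verts m n" "w \<in> C_verts m n" for u w
  proof -
    obtain i j i' j' where uw: "u = (i, j)" "w = (i', j')" by fastforce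
    have pos: "1 \<le> i" "1 \<le> j" "1 \<le> i'" "1 \<le> j'" using that by (auto simp: uw C_verts_def)
    have edge: "{u, w} \<in> C_edges m n k \<longleftrightarrow>
      i = i' \<and> (j' = j + 1 \<or> j = j' + 1) \<or> j = k \<and> j' = k \<and> (i' = i + 1 \<or> i = i' + 1)"
      using that unfolding uw by (subst C_edge_iff) (auto simp: C_verts_def)
    have "{u, w} \<in> C_edges m n k \<longleftrightarrow>
      ((i, j) = C_par k a b (i', j') \<and> (i', j') \<noteq> (a, b)) \<or>
      ((i', j') = C_par k a b (i, j) \<and> (i, j) \<noteq> (a, b))"
      unfolding edge C_par_iff[OF pos(1,2)] C_par_iff[OF pos(3,4)]
      by (cases "i = i'"; cases "i = a"; cases "i' = a"; simp; presburger)
    then show ?thesis unfolding uw by blast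
  qed
  show "C_hook m n k a b v =
      1 + sum (C_hook m n k a b) {w \<in> C_verts m n. w \<noteq> (a, b) \<and> C_par k a b w = v}"
    if "v \<in> C_verts m n" for v
  proof -
    obtain i j where v: "v = (Suc i, Suc j)" and ij: "i < m" "j < n"
      using \<open>v \<in> C_verts m n\<close> unfolding C_verts_def
      by (cases v) (auto simp: Suc_le_eq gr0_conv_Suc dest: less_imp_Suc_add)
    \<comment> \<open>Children can only be among the four neighbours, so the sum over them becomes
      four conditional summands.\<close>
    let ?N = "{(Suc i, Suc (Suc j)), (Suc i, j), (Suc (Suc i), Suc j), (i, Suc j)}"
    let ?P = "\<lambda>w. w \<in> C_verts m n \<and> w \<noteq> (a, b) \<and> C_par k a b w = v"
    have P: "v = C_par k a b (i2, j2) \<and> (i2, j2) \<noteq> (a, b) \<longleftrightarrow>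
      Suc i = i2 \<and> (if i2 = a then j2 < b \<and> Suc j = j2 + 1 \<or> j2 > b \<and> Suc j + 1 = j2
              else j2 < k \<and> Suc j = j2 + 1 \<or> j2 > k \<and> Suc j + 1 = j2) \<or>
      i2 \<noteq> a \<and> j2 = k \<and> Suc j = k \<and> (i2 < a \<and> Suc i = i2 + 1 \<or> i2 > a \<and> Suc i + 1 = i2)"
      if "1 \<le> i2" "1 \<le> j2" for i2 j2
      unfolding v by (rule C_par_iff[OF that])
    let ?g = "\<lambda>w. if ?P w then C_hook m n k a b w else 0"
    have "{w \<in> C_verts m n. w \<noteq> (a, b) \<and> C_par k a b w = v} = {w \<in> ?N. ?P w}"
      by (auto simp: v C_par_def C_verts_def split: if_splits)
    then have "sum (C_hook m n k a b) {w \<in> C_verts m n. w \<noteq> (a, b) \<and> C_par k a b w = v} = sum ?g ?N"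
      by (simp only: sum.inter_filter finite.intros)
    also have "\<dots> = ?g (Suc i, Suc (Suc j)) + ?g (Suc i, j) + ?g (Suc (Suc i), Suc j) + ?g (i, Suc j)"
      by (simp del: mem_Collect_eq)
    \<comment> \<open>At the border of the grid a neighbour is missing, and the closed forms vanish
      by themselves: \<open>n - Suc j\<close>, \<open>j\<close>, \<open>m - Suc i\<close> or
      \<open>i\<close> is then 0, and \<open>1 \<le> k \<le> n\<close> selects the right
      branch.\<close>
    also have "?g (Suc i, Suc (Suc j)) =
        (if (if Suc i = a then b else k) < j + 2
         then if k < j + 2 then n - Suc j else m * n - Suc j else 0)"
      using assms ij P[of "Suc i" "Suc (Suc j)"] by (auto simp: C_verts_def C_hook_def)
    also have "?g (Suc i, j) =
        (if j < (if Suc i = a then b else k) then if j < k then j else m * n - n + j else 0)"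
      using assms ij P[of "Suc i" j] by (cases "j = 0") (auto simp: C_verts_def C_hook_def)
    also have "?g (Suc (Suc i), Suc j) = (if Suc j = k \<and> a \<le> Suc i then (m - Suc i) * n else 0)"
      using assms ij P[of "Suc (Suc i)" "Suc j"] by (auto simp: C_verts_def C_hook_def)
    also have "?g (i, Suc j) = (if Suc j = k \<and> Suc i \<le> a then i * n else 0)"
      using assms ij P[of i "Suc j"] by (cases "i = 0") (auto simp: C_verts_def C_hook_def)
    finally have sum: "sum (C_hook m n k a b) {w \<in> C_verts m n. w \<noteq> (a, b) \<and> C_par k a b w = v} =
        (if (if Suc i = a then b else k) < j + 2
         then if k < j + 2 then n - Suc j else m * n - Suc j else 0) +
        (if j < (if Suc i = a then b else k) then if j < k then j else m * n - n + j else 0) +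
        (if Suc j = k \<and> a \<le> Suc i then (m - Suc i) * n else 0) +
        (if Suc j = k \<and> Suc i \<le> a then i * n else 0)" .
    have m: "m = i + Suc (m - Suc i)" using ij(1) by simp
    have "m * n = i * n + n + (m - Suc i) * n"
      by (subst m) (simp add: add_mult_distrib)
    moreover have "Suc i * n = i * n + n" "(m + 1 - Suc i) * n = (m - Suc i) * n + n"
      using ij(1) by (simp_all add: Suc_diff_Suc[symmetric])
    ultimately show ?thesis
      unfolding sum unfolding v C_hook_def prod.case
      using C_hook_recursion_arith[OF assms(1,2) ij(2) assms(5,6)] by presburger
  qed
qed

subsection \<open>Products of hook lengths and sums over the root\<close>

lemma prod_split_at:
  fixes f :: "nat \<Rightarrow> 'a::comm_monoid_mult"
  assumes "l \<le> c" "c \<le> u"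
  shows "prod f {l..u} = prod f {l..<c} * f c * prod f {c<..u}"
proof -
  have "{l..u} = insert c ({l..<c} \<union> {c<..u})" using assms by auto
  moreover have "prod f ({l..<c} \<union> {c<..u}) = prod f {l..<c} * prod f {c<..u}"
    by (rule prod.union_disjoint) auto
  ultimately show ?thesis by (simp add: ac_simps)
qed

lemma prod_id_below: "1 \<le> c \<Longrightarrow> (\<Prod>j\<in>{1..<c}. j) = (fact (c - 1) :: nat)"
  by (cases c) (auto simp: fact_prod atLeastLessThanSuc_atLeastAtMost)

lemma prod_rev_above: "(\<Prod>j\<in>{c<..u}. u + 1 - j) = (fact (u - c) :: nat)"
proof -
  have "(\<Prod>j\<in>{c<..u}. u + 1 - j) = \<Prod>{1..u - c}"
    by (rule prod.reindex_bij_witness[of _ "\<lambda>j. u + 1 - j" "\<lambda>j. u + 1 - j"]) auto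
  then show ?thesis by (simp add: fact_prod)
qed

text \<open>The quotient \<open>fact (N - b) / fact (N - k)\<close> without division; with
  \<open>N = m * n\<close> its factors are the hooks in row \<open>a\<close> after the root up to
  column \<open>k\<close>.\<close>

lemma prod_falling:
  assumes "b \<le> k" "k \<le> N"
  shows "(\<Prod>j\<in>{b<..k}. N + 1 - j) * fact (N - k) = (fact (N - b) :: nat)"
  using assms
proof (induction k rule: dec_induct)
  case (step k)
  have "{b<..Suc k} = insert (Suc k) {b<..k}" using step.hyps by auto
  moreover have "(fact (N - k) :: nat) = (N - k) * fact (N - Suc k)"
    using step.prems by (simp add: fact_reduce)
  ultimately show ?case using step by (simp add: mult_ac)
qed simp

text \<open>The counterpart for a root beyond column \<open>k\<close>, with
  \<open>c = m * n - n\<close>.\<close>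

lemma prod_rising:
  assumes "k \<le> b" "1 \<le> k"
  shows "(\<Prod>j\<in>{k..<b}. c + j) * fact (c + k - 1) = (fact (c + b - 1) :: nat)"
  using assms
proof (induction b rule: dec_induct)
  case (step b)
  have "(fact (c + b) :: nat) = (c + b) * fact (c + b - 1)"
    using step by (simp add: fact_reduce)
  then show ?case using step by (simp add: mult_ac)
qed simp

lemma sum_inverse_fact_product:
  assumes "1 \<le> m"
  shows "(\<Sum>a = 1..m. 1 / (fact (a - 1) * fact (m - a))) = (2 ^ (m - 1) / fact (m - 1) :: real)"
proof -
  have "(\<Sum>a = 1..m. 1 / (fact (a - 1) * fact (m - a))) =
      (\<Sum>i\<le>m - 1. real ((m - 1) choose i) / fact (m - 1))"
    by (rule sum.reindex_bij_witness[of _ Suc "\<lambda>a. a - 1"]) (use assms in \<open>auto simp: binomial_fact\<close>)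
  also have "\<dots> = 2 ^ (m - 1) / fact (m - 1)"
    by (simp flip: sum_divide_distrib of_nat_sum add: choose_row_sum)
  finally show ?thesis .
qed

text \<open>Pascal's rule splits the sum into two partial row sums for \<open>M'\<close>, up to
  \<open>Suc K\<close> and up to \<open>K\<close>. Taking off the top term leaves
  \<open>M' choose Suc K\<close>, the summand \<open>z = 0\<close>, plus twice the sum up to
  \<open>K\<close>, where the factor 2 shifts \<open>z\<close> by one.\<close>

lemma sum_binomial_eq_sum_power_two:
  "K < M \<Longrightarrow> (\<Sum>i\<le>K. M choose i) = (\<Sum>z\<le>K. 2 ^ z * ((M - 1 - z) choose (K - z)))"
proof (induction K arbitrary: M)
  case (Suc K)
  then obtain M' where M: "M = Suc M'" "K < M'" by (cases M) auto
  have "(\<Sum>i\<le>Suc K. Suc M' choose i) = 1 + (\<Sum>i\<le>K. M' choose Suc i) + (\<Sum>i\<le>K. M' choose i)"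
    by (simp add: sum.atMost_Suc_shift sum.distrib del: sum.atMost_Suc)
  also have "1 + (\<Sum>i\<le>K. M' choose Suc i) = (\<Sum>i\<le>Suc K. M' choose i)"
    by (subst sum.atMost_Suc_shift) simp
  also have "\<dots> + (\<Sum>i\<le>K. M' choose i) = (M' choose Suc K) + 2 * (\<Sum>i\<le>K. M' choose i)"
    by simp
  also have "\<dots> = (\<Sum>z\<le>Suc K. 2 ^ z * ((M' - z) choose (Suc K - z)))"
    by (subst sum.atMost_Suc_shift) (simp add: Suc.IH[OF M(2)] sum_distrib_left mult.assoc)
  finally show ?case by (simp add: M del: sum.atMost_Suc)
qed simp

text \<open>Each summand on the left is \<open>fact (N - k)\<close> times
  \<open>(N - 1) choose (b - 1)\<close>, so the sum is a partial row sum up to \<open>k - 2\<close>.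
  The previous identity applies with \<open>M = N - 1\<close> and \<open>y = z + 2\<close>.\<close>

lemma sum_roots_below:
  assumes "1 \<le> k" "k \<le> N"
  shows "(\<Sum>b\<in>{1..<k}. fact (N - 1) * fact (N - k) / (fact (b - 1) * fact (N - b))) =
    (\<Sum>y = 2..k. 2 ^ (y - 2) * fact (N - y) / fact (k - y) :: real)"
proof (cases "k = 1")
  case False
  then obtain K where K: "k = K + 2" using assms by (intro that[of "k - 2"]) linarith
  have "(\<Sum>b\<in>{1..<k}. fact (N - 1) * fact (N - k) / (fact (b - 1) * fact (N - b)) :: real) =
      (\<Sum>i\<le>K. fact (N - k) * real ((N - 1) choose i))"
    using assms K
    by (intro sum.reindex_bij_witness[of _ Suc "\<lambda>b. b - 1"]) (auto simp: binomial_fact)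
  also have "\<dots> = fact (N - k) * real (\<Sum>i\<le>K. (N - 1) choose i)"
    by (simp add: sum_distrib_left)
  also have "\<dots> = (\<Sum>z\<le>K. fact (N - k) * (2 ^ z * real ((N - 1 - 1 - z) choose (K - z))))"
    using assms K by (subst sum_binomial_eq_sum_power_two) (auto simp: sum_distrib_left)
  also have "\<dots> = (\<Sum>y = 2..k. 2 ^ (y - 2) * fact (N - y) / fact (k - y))"
  proof (rule sum.reindex_bij_witness[of _ "\<lambda>y. y - 2" "\<lambda>z. z + 2"])
    fix z assume z: "z \<in> {..K}"
    \<comment> \<open>\<open>N - y\<close> and \<open>k - y\<close> always differ by
      \<open>N - k\<close>, so the prefactor \<open>fact (N - k)\<close> cancels.\<close>
    have "real ((N - 1 - 1 - z) choose (K - z)) = fact (N - (z + 2)) / (fact (k - (z + 2)) * fact (N - k))"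
      using z assms K by (subst binomial_fact) (auto simp: diff_diff_eq)
    then show "2 ^ (z + 2 - 2) * fact (N - (z + 2)) / fact (k - (z + 2)) =
        fact (N - k) * (2 ^ z * real ((N - 1 - 1 - z) choose (K - z)))"
      by simp
  qed (use K in auto)
  finally show ?thesis .
qed simp

section \<open>Hook products by rows\<close>

lemma C_hook_row_other:
  assumes "1 \<le> k" "k \<le> n" "i \<noteq> a"
  shows "(\<Prod>j = 1..n. C_hook m n k a b (i, j)) =
    fact (k - 1) * fact (n - k) * n * (if i < a then i else m + 1 - i)"
proof -
  have "(\<Prod>j\<in>{1..<k}. C_hook m n k a b (i, j)) = (\<Prod>j\<in>{1..<k}. j)"
    using assms(3) by (intro prod.cong) (auto simp: C_hook_def)
  moreover have "(\<Prod>j\<in>{k<..n}. C_hook m n k a b (i, j)) = (\<Prod>j\<in>{k<..n}. n + 1 - j)"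
    using assms(3) by (intro prod.cong) (auto simp: C_hook_def)
  ultimately show ?thesis
    using assms unfolding prod_split_at[OF assms(1,2)] prod_id_below[OF assms(1)] prod_rev_above
    by (simp add: prod_id_below C_hook_def)
qed

text \<open>The columns before \<open>b\<close>, those after \<open>k\<close> and the root give
  \<open>fact (b - 1)\<close>, \<open>fact (n - k)\<close> and \<open>m * n\<close>. The falling
  product in between is a quotient whose denominator stands on the left.\<close>

lemma C_hook_row_root_below:
  assumes "1 \<le> b" "b \<le> k" "k \<le> n" "1 \<le> m"
  shows "(\<Prod>j = 1..n. C_hook m n k a b (a, j)) * fact (m * n - k) =
    fact (b - 1) * fact (n - k) * (m * n) * fact (m * n - b)"
proof -
  have "k \<le> m * n" using assms(3,4) by (metis le_trans mult_le_mono1 nat_mult_1)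
  have 1: "(\<Prod>j\<in>{1..<b}. C_hook m n k a b (a, j)) = fact (b - 1)"
    unfolding prod_id_below[OF assms(1), symmetric] using assms
    by (intro prod.cong) (auto simp: C_hook_def)
  have "{b<..n} = {b<..k} \<union> {k<..n}" using assms by auto
  then have "(\<Prod>j\<in>{b<..n}. C_hook m n k a b (a, j)) =
      (\<Prod>j\<in>{b<..k}. C_hook m n k a b (a, j)) * (\<Prod>j\<in>{k<..n}. C_hook m n k a b (a, j))"
    by (simp add: prod.union_disjoint)
  also have "(\<Prod>j\<in>{b<..k}. C_hook m n k a b (a, j)) = (\<Prod>j\<in>{b<..k}. m * n + 1 - j)"
    by (intro prod.cong) (auto simp: C_hook_def)
  also have "(\<Prod>j\<in>{k<..n}. C_hook m n k a b (a, j)) = fact (n - k)"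
    unfolding prod_rev_above[symmetric] using assms by (intro prod.cong) (auto simp: C_hook_def)
  finally have 2: "(\<Prod>j\<in>{b<..n}. C_hook m n k a b (a, j)) =
    (\<Prod>j\<in>{b<..k}. m * n + 1 - j) * fact (n - k)" .
  have 3: "C_hook m n k a b (a, b) = m * n" by (simp add: C_hook_def)
  show ?thesis
    unfolding prod_split_at[OF assms(1) le_trans[OF assms(2,3)]] 1 2 3
      prod_falling[OF assms(2) \<open>k \<le> m * n\<close>, symmetric]
    by (simp only: mult_ac)
qed

text \<open>Written so that it is the case \<open>b \<le> k\<close> with the columns reflected,
  \<open>k\<close> and \<open>b\<close> becoming \<open>n + 1 - k\<close> and
  \<open>n + 1 - b\<close>.\<close>

lemma C_hook_row_root_above:
  assumes "1 \<le> k" "k \<le> b" "b \<le> n" "1 \<le> m"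
  shows "(\<Prod>j = 1..n. C_hook m n k a b (a, j)) * fact (m * n - (n + 1 - k)) =
    fact (n - b) * fact (k - 1) * (m * n) * fact (m * n - (n + 1 - b))"
proof -
  have "n \<le> m * n" using assms(4) by simp
  then have eq: "m * n - (n + 1 - k) = m * n - n + k - 1" "m * n - (n + 1 - b) = m * n - n + b - 1"
    using assms by linarith+
  have 1: "(\<Prod>j\<in>{b<..n}. C_hook m n k a b (a, j)) = fact (n - b)"
    unfolding prod_rev_above[symmetric] using assms by (intro prod.cong) (auto simp: C_hook_def)
  have "{1..<b} = {1..<k} \<union> {k..<b}" using assms by auto
  then have "(\<Prod>j\<in>{1..<b}. C_hook m n k a b (a, j)) =
      (\<Prod>j\<in>{1..<k}. C_hook m n k a b (a, j)) * (\<Prod>j\<in>{k..<b}. C_hook m n k a b (a, j))"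
    by (simp add: prod.union_disjoint)
  also have "(\<Prod>j\<in>{k..<b}. C_hook m n k a b (a, j)) = (\<Prod>j\<in>{k..<b}. m * n - n + j)"
    by (intro prod.cong) (auto simp: C_hook_def)
  also have "(\<Prod>j\<in>{1..<k}. C_hook m n k a b (a, j)) = fact (k - 1)"
    unfolding prod_id_below[OF assms(1), symmetric] using assms
    by (intro prod.cong) (auto simp: C_hook_def)
  finally have 2: "(\<Prod>j\<in>{1..<b}. C_hook m n k a b (a, j)) =
    fact (k - 1) * (\<Prod>j\<in>{k..<b}. m * n - n + j)" .
  have 3: "C_hook m n k a b (a, b) = m * n" by (simp add: C_hook_def)
  show ?thesis
    unfolding eq prod_split_at[OF le_trans[OF assms(1,2)] assms(3)] 1 2 3
      prod_rising[OF assms(2,1), symmetric]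
    by (simp only: mult_ac)
qed

text \<open>The \<open>m - 1\<close> rows other than \<open>a\<close> share a common factor; their
  remaining factors from column \<open>k\<close> are \<open>i\<close> before row \<open>a\<close>
  and \<open>m + 1 - i\<close> after it, which multiply to the two factorials.\<close>

lemma prod_C_hook:
  assumes "1 \<le> k" "k \<le> n" "1 \<le> a" "a \<le> m"
  shows "prod (C_hook m n k a b) (C_verts m n) =
    (fact (k - 1) * fact (n - k) * n) ^ (m - 1) * (fact (a - 1) * fact (m - a)) *
    (\<Prod>j = 1..n. C_hook m n k a b (a, j))"
proof -
  let ?q = "fact (k - 1) * fact (n - k) * n"
  let ?row = "\<lambda>i. \<Prod>j = 1..n. C_hook m n k a b (i, j)"
  have "C_verts m n = {1..m} \<times> {1..n}" by (auto simp: C_verts_def)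
  then have "prod (C_hook m n k a b) (C_verts m n) = (\<Prod>i = 1..m. ?row i)"
    by (simp add: prod.cartesian_product)
  also have "\<dots> = (\<Prod>i\<in>{1..<a}. ?row i) * ?row a * (\<Prod>i\<in>{a<..m}. ?row i)"
    by (rule prod_split_at[OF assms(3,4)])
  also have "(\<Prod>i\<in>{1..<a}. ?row i) = (\<Prod>i\<in>{1..<a}. ?q * i)"
    using assms by (intro prod.cong refl) (subst C_hook_row_other; simp)
  also have "\<dots> = ?q ^ (a - 1) * fact (a - 1)"
    using prod_id_below[OF assms(3)] by (simp add: prod.distrib)
  also have "(\<Prod>i\<in>{a<..m}. ?row i) = (\<Prod>i\<in>{a<..m}. ?q * (m + 1 - i))"
    using assms by (intro prod.cong refl) (subst C_hook_row_other; simp)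
  also have "\<dots> = ?q ^ (m - a) * fact (m - a)"
    using prod_rev_above[of m a] by (simp add: prod.distrib)
  also have "?q ^ (a - 1) * fact (a - 1) * ?row a * (?q ^ (m - a) * fact (m - a)) =
      ?q ^ (a - 1 + (m - a)) * (fact (a - 1) * fact (m - a)) * ?row a"
    by (simp only: power_add mult_ac)
  also have "a - 1 + (m - a) = m - 1" using assms by simp
  finally show ?thesis .
qed

text \<open>\<open>p\<close> carries the whole dependence on \<open>a\<close> and its cofactor that
  on \<open>b\<close>, so the sum over all roots factors. The hook \<open>m * n\<close> of the root
  cancels against the leading factor of \<open>fact (m * n)\<close>.\<close>

lemma card_grows_C:
  assumes "1 \<le> k" "k \<le> n" "1 \<le> a" "a \<le> m" "1 \<le> b" "b \<le> n"
  defines "c \<equiv> card {g. grows (C_verts m n) (C_edges m n k) [(a, b) \<mapsto> 1] 1 g}"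
    and "p \<equiv> 1 / (fact (k - 1) * fact (n - k) * real n) ^ (m - 1) * (1 / (fact (a - 1) * fact (m - a)))"
  shows "b \<le> k \<Longrightarrow> real c = p *
      (fact (m * n - 1) * fact (m * n - k) / (fact (b - 1) * fact (m * n - b)) / fact (n - k))"
    and "k \<le> b \<Longrightarrow> real c = p *
      (fact (m * n - 1) * fact (m * n - (n + 1 - k)) /
        (fact (n - b) * fact (m * n - (n + 1 - b))) / fact (k - 1))"
proof -
  let ?R = "\<Prod>j = 1..n. C_hook m n k a b (a, j)"
  have N: "0 < m * n" using assms by simp
  interpret hook_tree "C_verts m n" "C_edges m n k" "(a, b)" "C_par k a b" "C_hook m n k a b"
    using assms by (intro C_hook_tree)
  have "C_verts m n = {1..m} \<times> {1..n}" by (auto simp: C_verts_def)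
  then have "card (C_verts m n) = m * n" by simp
  then have "c * prod (C_hook m n k a b) (C_verts m n) = m * n * fact (m * n - 1)"
    using hook_length_formula(2) N unfolding c_def by (metis fact_reduce of_nat_id)
  then have "c * ((fact (k - 1) * fact (n - k) * n) ^ (m - 1) * (fact (a - 1) * fact (m - a)) * ?R) =
      m * n * fact (m * n - 1)"
    by (simp only: prod_C_hook[OF assms(1-4)])
  from arg_cong[OF this, of real]
  have c: "real c * ((fact (k - 1) * fact (n - k) * n) ^ (m - 1) * (fact (a - 1) * fact (m - a)) * real ?R) =
      real (m * n) * fact (m * n - 1)"
    by (simp only: of_nat_mult of_nat_power of_nat_fact)
  have n: "real n \<noteq> 0" "real (m * n) \<noteq> 0" using N by auto
  \<comment> \<open>A zero hook product would make the nonzero right side of \<open>c\<close>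
    vanish.\<close>
  have "real ?R \<noteq> 0"
  proof
    assume "real ?R = 0"
    then have "real (m * n) * fact (m * n - 1) = (0 :: real)"
      using c by (simp only: mult_zero_right)
    then show False using n(2) by (simp only: mult_eq_0_iff fact_nonzero simp_thms)
  qed
  then have c': "real c = p * (real (m * n) * fact (m * n - 1) / real ?R)"
    using c n(1) unfolding p_def by (simp del: of_nat_prod add: field_simps)
  show "real c = p *
      (fact (m * n - 1) * fact (m * n - k) / (fact (b - 1) * fact (m * n - b)) / fact (n - k))"
    if "b \<le> k"
  proof -
    have "?R * fact (m * n - k) = fact (b - 1) * fact (n - k) * (m * n) * fact (m * n - b)"
      using assms that by (intro C_hook_row_root_below) auto
    from arg_cong[OF this, of real]
    have "real ?R * fact (m * n - k) = fact (b - 1) * fact (n - k) * real (m * n) * fact (m * n - b)"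
      by (simp only: of_nat_mult of_nat_fact)
    then have R: "real ?R = fact (b - 1) * fact (n - k) * real (m * n) * fact (m * n - b) / fact (m * n - k)"
      by (simp only: eq_divide_eq fact_nonzero simp_thms if_False if_True)
    show ?thesis unfolding c' R using n by (simp add: field_simps)
  qed
  show "real c = p *
      (fact (m * n - 1) * fact (m * n - (n + 1 - k)) /
        (fact (n - b) * fact (m * n - (n + 1 - b))) / fact (k - 1))"
    if "k \<le> b"
  proof -
    have "?R * fact (m * n - (n + 1 - k)) =
        fact (n - b) * fact (k - 1) * (m * n) * fact (m * n - (n + 1 - b))"
      using assms that by (intro C_hook_row_root_above) auto
    from arg_cong[OF this, of real]
    have "real ?R * fact (m * n - (n + 1 - k)) =
        fact (n - b) * fact (k - 1) * real (m * n) * fact (m * n - (n + 1 - b))"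
      by (simp only: of_nat_mult of_nat_fact)
    then have R: "real ?R = fact (n - b) * fact (k - 1) * real (m * n) * fact (m * n - (n + 1 - b)) /
        fact (m * n - (n + 1 - k))"
      by (simp only: eq_divide_eq fact_nonzero simp_thms if_False if_True)
    show ?thesis unfolding c' R using n by (simp add: field_simps)
  qed
qed

section \<open>Summation over all starting vertices\<close>

theorem theorem5:
  fixes m n k :: nat
  assumes "m \<ge> 2" and "n \<ge> 2" and "1 \<le> k" and "k \<le> n"
  shows "real (num_random_walk_labelings (C_verts m n) (C_edges m n k)) =
    1 / fact (m - 1) * (2 / fact n * real ((n - 1) choose (k - 1))) ^ (m - 1) *
    (1 / fact (n - k) * (\<Sum>y = 2..k. 2 ^ (y - 2) * fact (m * n - y) / fact (k - y)) +
     1 / fact (k - 1) *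
       (\<Sum>y = 2..n - k + 1. 2 ^ (y - 2) * fact (m * n - y) / fact (n - k + 1 - y)) +
     fact (m * n - 1) / (fact (n - k) * fact (k - 1)))"
proof -
  let ?V = "C_verts m n" and ?E = "C_edges m n k" and ?N = "m * n" and ?k' = "n + 1 - k"
  let ?c = "\<lambda>r. real (card {g. grows ?V ?E [r \<mapsto> 1] 1 g})"
  let ?p = "\<lambda>a. 1 / (fact (k - 1) * fact (n - k) * real n) ^ (m - 1) *
    (1 / (fact (a - 1) * fact (m - a)))"
  let ?T = "\<lambda>k b. fact (?N - 1) * fact (?N - k) / (fact (b - 1) * fact (?N - b)) :: real"
  \<comment> \<open>Beyond column \<open>k\<close> the term is that of the reflected column
    \<open>n + 1 - b\<close>.\<close>
  let ?S = "\<lambda>b. if b \<le> k then ?T k b / fact (n - k) else ?T ?k' (n + 1 - b) / fact (k - 1)"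
  have V: "?V = {1..m} \<times> {1..n}" by (auto simp: C_verts_def)
  have "n \<le> ?N" using assms by simp
  have "finite {g. grows ?V ?E [r \<mapsto> 1] 1 g}" if "r \<in> ?V" for r
  proof -
    obtain a b where r: "r = (a, b)" by fastforce
    interpret hook_tree ?V ?E r "C_par k a b" "C_hook m n k a b"
      using that assms unfolding r by (intro C_hook_tree) (auto simp: C_verts_def)
    show ?thesis by (rule hook_length_formula)
  qed
  then have "real (num_random_walk_labelings ?V ?E) = sum ?c ?V"
    by (subst num_random_walk_labelings_eq_sum) (auto simp: V)
  also have "\<dots> = (\<Sum>a = 1..m. \<Sum>b = 1..n. ?c (a, b))"
    unfolding V by (simp add: sum.cartesian_product)
  also have "\<dots> = (\<Sum>a = 1..m. \<Sum>b = 1..n. ?p a * ?S b)"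
  proof (intro sum.cong refl)
    fix a b assume ab: "a \<in> {1..m}" "b \<in> {1..n}"
    then have "n + 1 - b - 1 = n - b" by simp
    then show "?c (a, b) = ?p a * ?S b"
      using card_grows_C[of k n a m b] ab assms by (cases "b \<le> k") auto
  qed
  also have "\<dots> = (\<Sum>a = 1..m. ?p a) * (\<Sum>b = 1..n. ?S b)"
    by (simp only: sum_product)
  also have "(\<Sum>a = 1..m. ?p a) = 1 / fact (m - 1) * (2 / fact n * real ((n - 1) choose (k - 1))) ^ (m - 1)"
  proof -
    \<comment> \<open>The base is rewritten as 2 over the factor shared by the rows other than
      \<open>a\<close>; the sum over \<open>a\<close> supplies \<open>2 ^ (m - 1)\<close>.\<close>
    have "(fact n :: real) = real n * fact (n - 1)" using assms by (simp add: fact_reduce)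
    moreover have "real ((n - 1) choose (k - 1)) = fact (n - 1) / (fact (k - 1) * fact (n - k))"
      using assms by (simp add: binomial_fact)
    ultimately have "2 / fact n * real ((n - 1) choose (k - 1)) =
        2 / (fact (k - 1) * fact (n - k) * real n)"
      using assms by (simp add: field_simps)
    moreover have "(\<Sum>a = 1..m. ?p a) =
        1 / (fact (k - 1) * fact (n - k) * real n) ^ (m - 1) * (2 ^ (m - 1) / fact (m - 1))"
      using assms by (simp only: sum_distrib_left[symmetric] sum_inverse_fact_product)
    ultimately show ?thesis by (simp add: power_divide)
  qed
  also have "(\<Sum>b = 1..n. ?S b) =
     1 / fact (n - k) * (\<Sum>y = 2..k. 2 ^ (y - 2) * fact (m * n - y) / fact (k - y)) +
     1 / fact (k - 1) *
       (\<Sum>y = 2..n - k + 1. 2 ^ (y - 2) * fact (m * n - y) / fact (n - k + 1 - y)) +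
     fact (m * n - 1) / (fact (n - k) * fact (k - 1))"
  proof -
    \<comment> \<open>Roots in column \<open>k\<close> give the isolated last summand, the columns
      on either side give the two sums.\<close>
    have split: "{1..n} = insert k ({1..<k} \<union> {k<..n})" using assms by auto
    have e0: "(\<Sum>b = 1..n. ?S b) = ?S k + (sum ?S {1..<k} + sum ?S {k<..n})"
      unfolding split by (subst sum.insert; (subst sum.union_disjoint)?; force)
    have e1: "?S k = fact (m * n - 1) / (fact (n - k) * fact (k - 1))"
      by simp
    have e2: "sum ?S {1..<k} = (\<Sum>b\<in>{1..<k}. ?T k b) / fact (n - k)"
      unfolding sum_divide_distrib by (intro sum.cong) auto
    have e3: "(\<Sum>b\<in>{1..<k}. ?T k b) = (\<Sum>y = 2..k. 2 ^ (y - 2) * fact (m * n - y) / fact (k - y))"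
      using assms \<open>n \<le> ?N\<close> by (intro sum_roots_below) linarith+
    \<comment> \<open>Reflecting the columns turns roots beyond \<open>k\<close> into roots before
      \<open>?k'\<close>, so \<open>sum_roots_below\<close> serves both sides.\<close>
    have e4: "sum ?S {k<..n} = (\<Sum>b\<in>{1..<?k'}. ?T ?k' b) / fact (k - 1)"
      unfolding sum_divide_distrib
      by (rule sum.reindex_bij_witness[of _ "\<lambda>b. n + 1 - b" "\<lambda>b. n + 1 - b"]) auto
    have e5: "(\<Sum>b\<in>{1..<?k'}. ?T ?k' b) =
        (\<Sum>y = 2..?k'. 2 ^ (y - 2) * fact (m * n - y) / fact (?k' - y))"
      using assms \<open>n \<le> ?N\<close> by (intro sum_roots_below) linarith+
    have e6: "?k' = n - k + 1" using assms by simp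
    show ?thesis unfolding e0 e1 e2 e3 e4 e5 unfolding e6 by simp
  qed
  finally show ?thesis .
qed

end
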